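(* Let $V_n$, $n\ge0$, be the approximating graphs of the non-p.c.f. analog of the Sierpiński gasket (defined in the context). Then for all $n\ge0$, $$\tau(V_n)=2^{f_n}\cdot3^{g_n}\cdot5^{h_n},$$ where $f_n=\frac{2}{25}(11\cdot6^n-30n-11)$, $g_n=\frac15(2\cdot6^n+3)$ and $h_n=\frac1{25}(4\cdot6^n+30n-4)$.
   Context: The graphs $V_n$ are multigraphs (edges counted with multiplicity), each being a union of $6^n$ "cells", a cell being a triangle (three vertices with the three edges between them). $V_0$ is a single cell on vertices $x_1,x_2,x_3$ (the complete graph $K_3$). For $n\ge1$, $V_n$ is obtained from $V_{n-1}$ by replacing every cell with vertices $a,b,c$ by its barycentric subdivision: introduce four new vertices $u_{ab},u_{bc},u_{ca},o$ (new vertices introduced for different cells are distinct) and replace the cell by the six cells $\{a,u_{ab},o\},\{u_{ab},b,o\},\{b,u_{bc},o\},\{u_{bc},c,o\},\{c,u_{ca},o\},\{u_{ca},a,o\}$; the edge multiset of $V_n$ is the union (with multiplicity) of the edges of all its cells. $\tau(G)$ denotes the number of spanning trees of $G$. *)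

theory Defs
  imports Complex_Main
begin

text \<open>
  Multigraphs with labelled edges: parallel edges are distinct labels with the same ends.
\<close>

record ('v, 'e) multigraph =
  vertices :: "'v set"
  edges :: "'e set"
  ends :: "'e \<Rightarrow> 'v set"

definition connected_graph :: "('v, 'e) multigraph \<Rightarrow> bool" where
  "connected_graph G \<longleftrightarrow> vertices G \<noteq> {} \<and>
     (\<forall>u \<in> vertices G. \<forall>v \<in> vertices G.
        (u, v) \<in> {(x, y). \<exists>e \<in> edges G. ends G e = {x, y}}\<^sup>*)"

text \<open>
  A cycle visits the distinct vertices \<open>vs\<close> in order along the distinct edges \<open>es\<close> and returns to
  its start; a loop is a cycle of length 1 and a pair of parallel edges one of length 2.
\<close>

definition is_cycle :: "('v, 'e) multigraph \<Rightarrow> 'v list \<Rightarrow> 'e list \<Rightarrow> bool" where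
  "is_cycle G vs es \<longleftrightarrow>
     vs \<noteq> [] \<and> length es = length vs \<and> distinct vs \<and> distinct es \<and>
     set vs \<subseteq> vertices G \<and> set es \<subseteq> edges G \<and>
     (\<forall>i < length vs. ends G (es ! i) = {vs ! i, vs ! (Suc i mod length vs)})"

definition is_tree :: "('v, 'e) multigraph \<Rightarrow> bool" where
  "is_tree G \<longleftrightarrow> connected_graph G \<and> (\<nexists>vs es. is_cycle G vs es)"

definition spanning_trees :: "('v, 'e) multigraph \<Rightarrow> 'e set set" where
  "spanning_trees G = {T. T \<subseteq> edges G \<and> is_tree (G\<lparr>edges := T\<rparr>)}"

definition tau :: "('v, 'e) multigraph \<Rightarrow> nat" where
  "tau G = card (spanning_trees G)"

text \<open>
  A vertex introduced by subdividing a cell \<open>C\<close> is named after \<open>C\<close>: \<open>Mid C a b\<close> is the vertex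
  \<open>u\<^sub>a\<^sub>b\<close> and \<open>Bary C\<close> the vertex \<open>o\<close>. This makes the vertices introduced for different cells distinct.
  The order of the three vertices of a cell carries no meaning.
\<close>

datatype vertex = Corner nat | Mid cell vertex vertex | Bary cell
  and cell = Cell vertex vertex vertex

fun cell_vertices :: "cell \<Rightarrow> vertex set" where
  "cell_vertices (Cell a b c) = {a, b, c}"

fun cell_sides :: "cell \<Rightarrow> vertex set set" where
  "cell_sides (Cell a b c) = {{a, b}, {b, c}, {c, a}}"

fun subdivide :: "cell \<Rightarrow> cell set" where
  "subdivide (Cell a b c) =
     (let C = Cell a b c; o' = Bary C in
       {Cell a (Mid C a b) o', Cell (Mid C a b) b o',
        Cell b (Mid C b c) o', Cell (Mid C b c) c o',
        Cell c (Mid C c a) o', Cell (Mid C c a) a o'})"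

primrec cells :: "nat \<Rightarrow> cell set" where
  "cells 0 = {Cell (Corner 1) (Corner 2) (Corner 3)}"
| "cells (Suc n) = (\<Union>C \<in> cells n. subdivide C)"

text \<open>
  Tagging each side with its cell yields the union with multiplicity of the edges of all cells.
\<close>

definition gasket_graph :: "nat \<Rightarrow> (vertex, cell \<times> vertex set) multigraph" where
  "gasket_graph n =
     \<lparr>vertices = (\<Union>C \<in> cells n. cell_vertices C),
      edges = (SIGMA C : cells n. cell_sides C),
      ends = snd\<rparr>"

text \<open>
  The encoding is sound: cells have three distinct vertices and three distinct sides, there are
  \<open>6 ^ n\<close> of them at level \<open>n\<close>, and the vertices introduced at each step are new.
\<close>

lemma subdivide_third: "D \<in> subdivide C \<Longrightarrow> \<exists>a b. D = Cell a b (Bary C)"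
  by (cases C) (auto simp: Let_def)

lemma cells_level_unique: "C \<in> cells m \<Longrightarrow> C \<in> cells n \<Longrightarrow> m = n"
proof (induction m arbitrary: n C)
  case 0
  then show ?case by (cases n) (auto dest: subdivide_third)
next
  case (Suc m)
  show ?case
  proof (cases n)
    case 0
    with Suc.prems show ?thesis by (auto dest: subdivide_third)
  next
    case (Suc k)
    with Suc.prems Suc.IH[of _ k] show ?thesis by (auto dest!: subdivide_third)
  qed
qed

lemma vertex_origin:
  assumes "C \<in> cells n" "v \<in> cell_vertices C"
  shows "(v = Bary D \<longrightarrow> (\<exists>m < n. D \<in> cells m)) \<and> (v = Mid D x y \<longrightarrow> (\<exists>m < n. D \<in> cells m))"
  using assms
proof (induction n arbitrary: C v)
  case 0
  then show ?case by auto
next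
  case (Suc n)
  then obtain B where B: "B \<in> cells n" "C \<in> subdivide B" by auto
  obtain a b c where abc: "B = Cell a b c" by (cases B)
  have "v \<in> cell_vertices B \<or> v = Bary B \<or> (\<exists>x y. v = Mid B x y)"
    using B(2) Suc.prems(2) by (auto simp: abc Let_def)
  then show ?case using Suc.IH[OF B(1), of v] B(1) less_SucI by blast
qed

lemma new_vertices_fresh:
  assumes "C \<in> cells n"
  shows "Bary C \<notin> vertices (gasket_graph n)" "Mid C x y \<notin> vertices (gasket_graph n)"
proof -
  have "\<not> (\<exists>m < n. C \<in> cells m)"
    using assms cells_level_unique by blast
  then show "Bary C \<notin> vertices (gasket_graph n)" "Mid C x y \<notin> vertices (gasket_graph n)"
    using vertex_origin by (simp_all add: gasket_graph_def) blast+
qed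

lemma cells_distinct:
  assumes "Cell a b c \<in> cells n"
  shows "distinct [a, b, c]"
  using assms
proof (induction n arbitrary: a b c)
  case 0
  then show ?case by simp
next
  case (Suc n)
  then obtain B where B: "B \<in> cells n" "Cell a b c \<in> subdivide B" by auto
  obtain p q r where pqr: "B = Cell p q r" by (cases B)
  have fresh: "Bary B \<notin> {p, q, r}" "Mid B x y \<notin> {p, q, r}" for x y
    using new_vertices_fresh[OF B(1)] B(1) by (auto simp: gasket_graph_def pqr)
  show ?case using B(2) fresh by (auto simp: pqr Let_def)
qed

lemma card_cell_vertices: "C \<in> cells n \<Longrightarrow> card (cell_vertices C) = 3"
  by (cases C) (auto dest: cells_distinct)

lemma card_cell_sides: "C \<in> cells n \<Longrightarrow> card (cell_sides C) = 3"
  by (cases C) (auto dest!: cells_distinct simp: card_insert_if doubleton_eq_iff)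

lemma card_subdivide:
  assumes "C \<in> cells n"
  shows "card (subdivide C) = 6"
proof -
  obtain a b c where abc: "C = Cell a b c" by (cases C)
  have fresh: "Mid C x y \<notin> {a, b, c}" for x y
    using new_vertices_fresh[OF assms] assms by (auto simp: gasket_graph_def abc)
  have "distinct [a, b, c]" using assms cells_distinct abc by blast
  moreover have "a \<noteq> Mid C x y" "b \<noteq> Mid C x y" "c \<noteq> Mid C x y" for x y
    using fresh[of x y] by auto
  moreover have "subdivide C =
      {Cell a (Mid C a b) (Bary C), Cell (Mid C a b) b (Bary C),
       Cell b (Mid C b c) (Bary C), Cell (Mid C b c) c (Bary C),
       Cell c (Mid C c a) (Bary C), Cell (Mid C c a) a (Bary C)}"
    by (simp add: abc Let_def)
  ultimately show ?thesis by (auto simp: card_insert_if)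
qed

lemma finite_cells: "finite (cells n)"
proof (induction n)
  case (Suc n)
  have "finite (subdivide C)" for C by (cases C) (simp add: Let_def)
  then show ?case using Suc by simp
qed simp

lemma card_cells: "card (cells n) = 6 ^ n"
proof (induction n)
  case (Suc n)
  have "card (cells (Suc n)) = (\<Sum>C \<in> cells n. card (subdivide C))"
    unfolding cells.simps
    by (rule card_UN_disjoint)
       (auto simp: finite_cells dest!: subdivide_third card_subdivide intro: card_ge_0_finite)
  also have "\<dots> = 6 ^ Suc n" using Suc by (simp add: card_subdivide)
  finally show ?case .
qed simp

end

theory Submission
  imports Defs "HOL-Library.Multiset"
begin

text \<open>
  Weighted spanning tree sums are multiplied by known constants under two local moves: parallel edges
  may be merged by adding weights, and a vertex joined to \<open>a, b, c\<close> only, with weights \<open>p, q, r\<close> of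
  sum \<open>s\<close>, may be replaced by a triangle with weights \<open>p q / s, q r / s, r p / s\<close> at the cost of a
  factor \<open>s\<close>. In a subdivided cell with unit weights, eliminating the three midpoints costs a factor
  \<open>4\<close> each and leaves the barycentre with three edges of weight \<open>3\<close>; eliminating it costs \<open>9\<close> and
  leaves the original cell with weights \<open>1/4 + 1 = 5/4\<close>. Since a spanning tree of \<open>V\<^sub>n\<close> has
  \<open>|V\<^sub>n| - 1 = (4 * 6\<^sup>n + 6) / 5\<close> edges, it follows that
  \<open>\<tau>(V\<^sub>n\<^sub>+\<^sub>1) = 576 ^ (6 ^ n) * (5/4) ^ (|V\<^sub>n| - 1) * \<tau>(V\<^sub>n)\<close>.
\<close>

section \<open>Weighted spanning tree sums\<close>

text \<open>For an equivalence \<open>P\<close> this is already transitive: it is the least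
  equivalence containing \<open>P\<close> and the pair \<open>u\<close>, \<open>v\<close>, so
  joining models the contraction of an edge between \<open>u\<close> and \<open>v\<close>.\<close>

definition join :: "('v \<Rightarrow> 'v \<Rightarrow> bool) \<Rightarrow> 'v \<Rightarrow> 'v \<Rightarrow> 'v \<Rightarrow> 'v \<Rightarrow> bool" where
  "join P u v = (\<lambda>x y. P x y \<or> P x u \<and> P v y \<or> P x v \<and> P u y)"

text \<open>
  The total weight of the edge sets that complete the classes of \<open>P\<close> to a spanning tree on \<open>V\<close>, by
  deletion and contraction; \<open>P\<close> records what has been contracted so far.
\<close>

fun tree_sum :: "'v set \<Rightarrow> ('v \<Rightarrow> 'v \<Rightarrow> bool) \<Rightarrow> ('v \<times> 'v \<times> real) list \<Rightarrow> real" where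
  "tree_sum V P [] = (if \<forall>x\<in>V. \<forall>y\<in>V. P x y then 1 else 0)"
| "tree_sum V P ((u, v, w) # es) =
     tree_sum V P es + (if P u v then 0 else w * tree_sum V (join P u v) es)"

text \<open>Sending \<open>x\<close> to its class \<open>P x\<close> turns an equivalence into
  equality of values, which reduces questions about joins to propositional reasoning on
  equations.\<close>

lemma equivp_kernel:
  fixes P :: "'v \<Rightarrow> 'v \<Rightarrow> bool"
  assumes "equivp P"
  obtains f :: "'v \<Rightarrow> 'v \<Rightarrow> bool" where "\<And>x y. P x y = (f x = f y)"
  using assms unfolding equivp_def by blast

lemma equivp_join:
  fixes P :: "'v \<Rightarrow> 'v \<Rightarrow> bool"
  assumes "equivp P"
  shows "equivp (join P u v)"
proof (rule equivpI)
  obtain f :: "'v \<Rightarrow> 'v \<Rightarrow> bool" where f: "\<And>x y. P x y = (f x = f y)" using equivp_kernel[OF assms] by blast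
  show "reflp (join P u v)" unfolding join_def reflp_def f by simp
  show "symp (join P u v)" unfolding join_def symp_def f by auto
  show "transp (join P u v)" unfolding join_def transp_def f by auto
qed

lemma join_mono: "P x y \<Longrightarrow> join P u v x y"
  by (simp add: join_def)

lemma join_edge: "equivp P \<Longrightarrow> join P u v u v"
  by (simp add: join_def equivp_reflp)

lemma join_least:
  assumes "equivp Q" "\<And>x y. P x y \<Longrightarrow> Q x y" "Q u v" "join P u v x y"
  shows "Q x y"
  using assms equivp_symp[OF assms(1)] equivp_transp[OF assms(1)] unfolding join_def by metis

text \<open>Both iterated joins are the least equivalence containing \<open>P\<close> and the two
  pairs; this inclusion and its mirror image give equality.\<close>

lemma join_commute_le:
  assumes "equivp P" "join (join P u v) x y s t"
  shows "join (join P x y) u v s t"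
proof (rule join_least[OF _ _ _ assms(2)])
  show "join (join P x y) u v r s" if "join P u v r s" for r s
    by (rule join_least[OF _ _ _ that]) (auto intro!: equivp_join join_mono join_edge assms(1))
qed (auto intro!: equivp_join join_mono join_edge assms(1))

lemma join_commute: "equivp P \<Longrightarrow> join (join P u v) x y = join (join P x y) u v"
  by (intro ext iffI) (rule join_commute_le; assumption)+

lemma join_sym: "join P u v = join P v u"
  by (auto simp: join_def)

section \<open>Reordering and merging edges in a tree sum\<close>

lemma tree_sum_swap:
  fixes P :: "'v \<Rightarrow> 'v \<Rightarrow> bool"
  assumes "equivp P"
  shows "tree_sum V P (e # f # es) = tree_sum V P (f # e # es)"
proof -
  obtain u v w where e: "e = (u, v, w)" by (cases e)
  obtain x y z where f: "f = (x, y, z)" by (cases f)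
  obtain k :: "'v \<Rightarrow> 'v \<Rightarrow> bool" where k: "\<And>x y. P x y = (k x = k y)" using equivp_kernel[OF assms] by blast
  \<comment> \<open>The term that contracts both edges is present under the same condition in either
    order, and commuting joins make the two relations equal.\<close>
  have "(\<not> P u v \<and> \<not> join P u v x y) = (\<not> P x y \<and> \<not> join P x y u v)"
    unfolding join_def k by argo
  then show ?thesis
    by (auto simp: e f join_commute[OF assms, of u v x y] algebra_simps)
qed

lemma tree_sum_Cons_cong:
  assumes "equivp P" "\<And>P. equivp P \<Longrightarrow> tree_sum V P es = tree_sum V P fs"
  shows "tree_sum V P (e # es) = tree_sum V P (e # fs)"
  using assms by (cases e) (simp add: equivp_join)

lemma tree_sum_Cons_append:
  assumes "equivp P"
  shows "tree_sum V P (e # xs @ ys) = tree_sum V P (xs @ e # ys)"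
  using assms
proof (induction xs arbitrary: P)
  case (Cons x xs)
  have "tree_sum V P (e # (x # xs) @ ys) = tree_sum V P (x # e # xs @ ys)"
    using tree_sum_swap[OF Cons.prems] by simp
  also have "\<dots> = tree_sum V P (x # xs @ e # ys)"
    by (rule tree_sum_Cons_cong[OF Cons.prems]) (rule Cons.IH)
  finally show ?case by simp
qed simp

text \<open>Allows any edges to be brought to the front, where the local moves act. The head of one
  list is located in the other and carried there by repeated swaps.\<close>

lemma tree_sum_mset:
  assumes "equivp P" "mset es = mset fs"
  shows "tree_sum V P es = tree_sum V P fs"
  using assms
proof (induction es arbitrary: fs P)
  case (Cons e es)
  then have "e \<in> set fs" by (metis list.set_intros(1) mset_eq_setD)
  then obtain xs ys where fs: "fs = xs @ e # ys" by (meson split_list)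
  then have "mset es = mset (xs @ ys)" using Cons.prems by simp
  then have "tree_sum V P (e # es) = tree_sum V P (e # xs @ ys)"
    using Cons.IH tree_sum_Cons_cong[OF Cons.prems(1)] by blast
  then show ?case using fs tree_sum_Cons_append[OF Cons.prems(1)] by metis
qed simp

lemma tree_sum_flip:
  fixes P :: "'v \<Rightarrow> 'v \<Rightarrow> bool"
  assumes "equivp P"
  shows "tree_sum V P ((u, v, w) # es) = tree_sum V P ((v, u, w) # es)"
  using join_sym[of P u v] equivp_symp[OF assms, of u v] equivp_symp[OF assms, of v u]
  by auto

text \<open>Once one of two parallel edges is contracted, the other is a loop and can only be
  deleted, so no term uses both and the weights add.\<close>

lemma tree_sum_parallel:
  assumes "equivp P"
  shows "tree_sum V P ((u, v, w) # (u, v, w') # es) = tree_sum V P ((u, v, w + w') # es)"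
proof -
  have "join P u v u v"
    using equivp_reflp[OF assms] by (simp add: join_def)
  then show ?thesis by (simp add: algebra_simps)
qed

section \<open>Star-triangle elimination of a vertex\<close>

lemma tree_sum_isolated:
  assumes "z \<in> V" "z \<noteq> o'" "\<And>x. Q o' x \<Longrightarrow> x = o'"
    and "\<And>e. e \<in> set es \<Longrightarrow> fst e \<noteq> o' \<and> fst (snd e) \<noteq> o'"
  shows "tree_sum (insert o' V) Q es = 0"
  using assms(3,4)
proof (induction es arbitrary: Q)
  case Nil
  then show ?case using assms(1,2) by auto
next
  case (Cons e es)
  obtain u v w where e: "e = (u, v, w)" by (cases e)
  \<comment> \<open>No edge in the list meets \<open>o'\<close>, so contraction leaves its class a
    singleton, and the final test fails for \<open>o'\<close> and \<open>z\<close>.\<close>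
  have "join Q u v o' x \<Longrightarrow> x = o'" for x
    using Cons.prems(1) Cons.prems(2)[of e] by (auto simp: join_def e)
  then show ?case using Cons by (simp add: e)
qed

text \<open>With \<open>o'\<close> and \<open>z\<close> equivalent, the final test on
  \<open>insert o' V\<close> asks no more than the test on \<open>V\<close>. The relations
  \<open>Q\<close> and \<open>Q'\<close> may differ at \<open>o'\<close>, because no edge in the
  list meets that vertex.\<close>

lemma tree_sum_drop_vertex:
  fixes V :: "'v set"
  assumes "o' \<notin> V" "z \<in> V"
    and "equivp Q" "Q o' z" "\<And>x y. x \<noteq> o' \<Longrightarrow> y \<noteq> o' \<Longrightarrow> Q x y = Q' x y"
    and "\<And>e. e \<in> set es \<Longrightarrow> fst e \<noteq> o' \<and> fst (snd e) \<noteq> o'"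
  shows "tree_sum (insert o' V) Q es = tree_sum V Q' es"
  using assms(3-)
proof (induction es arbitrary: Q Q')
  case Nil
  obtain k :: "'v \<Rightarrow> 'v \<Rightarrow> bool" where k: "\<And>x y. Q x y = (k x = k y)" using equivp_kernel[OF Nil.prems(1)] by blast
  have eq: "(\<forall>x\<in>V. \<forall>y\<in>V. Q x y) = (\<forall>x\<in>V. \<forall>y\<in>V. Q' x y)"
    by (intro ball_cong refl Nil.prems(3)) (use assms(1) in auto)
  have "(\<forall>x\<in>insert o' V. \<forall>y\<in>insert o' V. Q x y) = (\<forall>x\<in>V. \<forall>y\<in>V. Q x y)"
    using Nil.prems(2) assms(2) unfolding k by auto
  with eq show ?case by simp
next
  case (Cons e es)
  obtain u v w where e: "e = (u, v, w)" by (cases e)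
  have uv: "u \<noteq> o'" "v \<noteq> o'" using Cons.prems(4)[of e] by (auto simp: e)
  have "tree_sum (insert o' V) (join Q u v) es = tree_sum V (join Q' u v) es"
  proof (rule Cons.IH)
    show "join Q u v o' z" using Cons.prems(2) by (simp add: join_def)
    show "join Q u v x y = join Q' u v x y" if "x \<noteq> o'" "y \<noteq> o'" for x y
      using Cons.prems(3) uv that by (simp add: join_def)
  qed (use Cons.prems in \<open>auto intro: equivp_join\<close>)
  moreover have "tree_sum (insert o' V) Q es = tree_sum V Q' es"
    by (rule Cons.IH) (use Cons.prems in auto)
  ultimately show ?case using Cons.prems(3)[OF uv] by (simp add: e)
qed

text \<open>\<open>Q\<close> is \<open>P\<close> with \<open>o'\<close> added to the class of \<open>a\<close>.\<close>

definition absorbed :: "'v \<Rightarrow> ('v \<Rightarrow> 'v \<Rightarrow> bool) \<Rightarrow> ('v \<Rightarrow> 'v \<Rightarrow> bool) \<Rightarrow> 'v \<Rightarrow> bool" where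
  "absorbed o' Q P a \<longleftrightarrow> (\<forall>s t. s \<noteq> o' \<longrightarrow> t \<noteq> o' \<longrightarrow> Q s t = P s t \<and> Q o' t = P a t \<and> Q s o' = P s a)"

text \<open>Since \<open>o'\<close> stands for the class of \<open>a\<close>, linking it to
  \<open>b\<close> has the same effect on the other vertices as linking \<open>a\<close> to
  \<open>b\<close>.\<close>

lemma absorbed_join:
  assumes "absorbed o' Q P a" "equivp Q" "equivp P" "a \<noteq> o'" "b \<noteq> o'"
  shows "absorbed o' (join Q o' b) (join P a b) a"
  using assms(1,4,5) equivp_reflp[OF assms(2), of o'] equivp_reflp[OF assms(3), of a]
  unfolding absorbed_def join_def by simp

lemma tree_sum_absorbed:
  assumes "absorbed o' Q P a" "equivp Q" "equivp P" "a \<in> V" "o' \<notin> V"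
    and "\<And>e. e \<in> set es \<Longrightarrow> fst e \<noteq> o' \<and> fst (snd e) \<noteq> o'"
  shows "tree_sum (insert o' V) Q es = tree_sum V P es"
proof (rule tree_sum_drop_vertex[OF assms(5,4,2) _ _ assms(6)])
  show "Q o' a" using assms(1,4,5) equivp_reflp[OF assms(3)] unfolding absorbed_def by metis
  show "Q x y = P x y" if "x \<noteq> o'" "y \<noteq> o'" for x y
    using assms(1) that unfolding absorbed_def by blast
qed auto


text \<open>Both sides are expanded over the subsets of the three distinguished edges. Choosing no
  star edge contributes nothing, the single star edges together give \<open>s\<close> times the
  plain sum, two star edges match one triangle edge, and all three match the choices of two triangle
  edges.\<close>

lemma star_triangle:
  fixes p q r :: real and P :: "'v \<Rightarrow> 'v \<Rightarrow> bool"
  assumes "equivp P" "\<And>x. P o' x \<Longrightarrow> x = o'" "o' \<notin> V" "a \<in> V" "b \<in> V" "c \<in> V"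
    and es: "\<And>e. e \<in> set es \<Longrightarrow> fst e \<noteq> o' \<and> fst (snd e) \<noteq> o'"
    and s: "s = p + q + r" "s \<noteq> 0"
  shows "tree_sum (insert o' V) P ((o', a, p) # (o', b, q) # (o', c, r) # es) =
    s * tree_sum V P ((a, b, p * q / s) # (b, c, q * r / s) # (c, a, r * p / s) # es)"
proof -
  note P = equivp_reflp[OF assms(1)] equivp_symp[OF assms(1)] equivp_transp[OF assms(1)]
  obtain k :: "'v \<Rightarrow> 'v \<Rightarrow> bool" where k: "\<And>x y. P x y = (k x = k y)"
    using equivp_kernel[OF assms(1)] by blast
  have abc: "a \<noteq> o'" "b \<noteq> o'" "c \<noteq> o'" using assms(3-6) by auto
  have iso: "\<not> P o' x" "\<not> P x o'" if "x \<noteq> o'" for x using assms(2) P(2) that by blast+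
  have zero: "tree_sum (insert o' V) P es = 0"
    by (rule tree_sum_isolated[OF assms(4) abc(1) assms(2) es])
  have E: "equivp (join P x y)" "equivp (join (join P x y) z w)" "equivp (join (join (join P x y) z w) s t)" for x y z w s t
    by (intro equivp_join assms(1))+
  \<comment> \<open>One contracted star edge makes \<open>o'\<close> a copy of its other end
    \<open>x\<close>; each further one links its own end to \<open>x\<close>.\<close>
  have A1: "absorbed o' (join P o' x) P x" if "x \<noteq> o'" for x
    using iso that P(1) unfolding absorbed_def join_def by auto
  have A2: "absorbed o' (join (join P o' x) o' y) (join P x y) x" if "x \<noteq> o'" "y \<noteq> o'" for x y
    using absorbed_join[OF A1[OF that(1)] E(1) assms(1) that] .
  have A3: "absorbed o' (join (join (join P o' a) o' b) o' c) (join (join P a b) a c) a"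
    using absorbed_join[OF A2[OF abc(1,2)] E(2,1) abc(1,3)] .
  have one: "tree_sum (insert o' V) (join P o' x) es = tree_sum V P es" if "x \<in> V" "x \<noteq> o'" for x
    by (rule tree_sum_absorbed[OF A1[OF that(2)] E(1) assms(1) that(1) assms(3) es])
  have two: "tree_sum (insert o' V) (join (join P o' x) o' y) es = tree_sum V (join P x y) es"
    if "x \<in> V" "x \<noteq> o'" "y \<noteq> o'" for x y
    by (rule tree_sum_absorbed[OF A2[OF that(2,3)] E(2,1) that(1) assms(3) es])
  have three: "tree_sum (insert o' V) (join (join (join P o' a) o' b) o' c) es =
      tree_sum V (join (join P a b) a c) es"
    by (rule tree_sum_absorbed[OF A3 E(3,2) assms(4) assms(3) es])
  have c1: "\<not> P o' a" "\<not> P o' b" "\<not> P o' c" using iso abc by auto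
  have c2: "join P o' x o' y = P x y" if "x \<noteq> o'" "y \<noteq> o'" for x y
    using A1[OF that(1)] that(2) unfolding absorbed_def by blast
  have c3: "join (join P o' a) o' b o' c = join P a b a c"
    using A2[OF abc(1,2)] abc(3) unfolding absorbed_def by blast
  have d: "join P a b a c = (P b c \<or> P c a)" "join P a b b c = (P b c \<or> P c a)"
    "join P a b c a = (P b c \<or> P c a)" "join P b c c a = (P c a \<or> P a b)"
    unfolding join_def k by auto
  have d5: "join (join P x y) y z x z" for x y z
    by (rule equivp_transp[OF E(2), of _ _ _ _ _ y]) (intro join_mono join_edge assms(1) E)+
  have d4: "join (join P a b) b c c a"
    by (rule equivp_symp[OF E(2)]) (rule d5)
  have le: "join (join P x y) y z s t" if "join (join P x y) x z s t" for x y z s t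
    by (rule join_least[OF E(2) _ d5 that]) (rule join_mono)
  \<comment> \<open>Any two sides of a triangle connect its three vertices to the same effect, so
    all double contractions can be brought into one form.\<close>
  have e0: "join (join P x y) x z = join (join P x y) y z" for x y z
    using le[of x y z] le[of y x z] join_sym[of P x y] by (intro ext iffI) simp_all
  have e1: "join (join P a b) a c = join (join P a b) b c"
    by (rule e0)
  have e2: "join (join P a b) c a = join (join P a b) b c"
    using e0 join_sym by metis
  have e3: "join (join P b c) c a = join (join P a b) b c"
    using e0[of b c a] join_commute[OF assms(1)] join_sym[of P a b] by metis
  have P': "P b a = P a b" "P c b = P b c" "P a c = P c a" using P(2) by blast+
  have tr: "P a b \<Longrightarrow> P b c = P c a" "P b c \<Longrightarrow> P a b = P c a" using P by blast+
  have L: "tree_sum (insert o' V) P ((o', a, p) # (o', b, q) # (o', c, r) # es) =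
     s * tree_sum V P es + (if P a b then 0 else p * q * tree_sum V (join P a b) es)
     + (if P b c then 0 else q * r * tree_sum V (join P b c) es)
     + (if P c a then 0 else r * p * tree_sum V (join P c a) es)
     + (if P a b \<or> P b c \<or> P c a then 0 else p * q * r * tree_sum V (join (join P a b) b c) es)"
    using zero one two three c1 c2 abc c3 d d4 e1 P' assms(4-6) join_sym[of P a c]
    by (auto simp: s algebra_simps)
  have R: "tree_sum V P ((a, b, p * q / s) # (b, c, q * r / s) # (c, a, r * p / s) # es) =
      tree_sum V P es + (if P a b then 0 else p * q / s * tree_sum V (join P a b) es)
     + (if P b c then 0 else q * r / s * tree_sum V (join P b c) es)
     + (if P c a then 0 else r * p / s * tree_sum V (join P c a) es)
     + (if P a b \<or> P b c \<or> P c a then 0 else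
         (p * q / s * (q * r / s) + p * q / s * (r * p / s) + q * r / s * (r * p / s))
           * tree_sum V (join (join P a b) b c) es)"
    using d d4 P' tr e2 e3 by (auto simp: algebra_simps)
  \<comment> \<open>The three pairs of triangle edges together weigh
    \<open>p q r (p + q + r) / s^2\<close>, which equals \<open>p q r / s\<close>.\<close>
  define N where "N = p * q / s * (q * r / s) + p * q / s * (r * p / s) + q * r / s * (r * p / s)"
  have N: "p * q * r = s * N"
    unfolding N_def using s(2) by (simp add: field_simps) (simp add: s(1) algebra_simps power2_eq_square)
  show ?thesis unfolding L R N_def[symmetric] N using s(2) by (simp add: distrib_left)
qed

section \<open>Collapsing one subdivided cell\<close>

definition triangle :: "real \<Rightarrow> 'v \<Rightarrow> 'v \<Rightarrow> 'v \<Rightarrow> ('v \<times> 'v \<times> real) list" where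
  "triangle w a b c = [(a, b, w), (b, c, w), (c, a, w)]"

text \<open>The midpoint \<open>u\<close> lies on the subcells \<open>a u z\<close> and
  \<open>u b z\<close>, so it is joined once to \<open>a\<close>, once to \<open>b\<close> and twice
  to \<open>z\<close>. The star weights \<open>2, 1, 1\<close> have sum \<open>4\<close> and yield
  \<open>1/2\<close> on each of \<open>z a\<close> and \<open>z b\<close>, added to the unit edges
  already there, and \<open>1/4\<close> on \<open>a b\<close>.\<close>

lemma eliminate_midpoint:
  assumes "equivp P" "\<And>x. P u x \<Longrightarrow> x = u" "u \<notin> V" "a \<in> V" "b \<in> V" "z \<in> V"
    and es: "\<And>e. e \<in> set es \<Longrightarrow> fst e \<noteq> u \<and> fst (snd e) \<noteq> u"
  shows "tree_sum (insert u V) P (triangle 1 a u z @ triangle 1 u b z @ es) =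
    4 * tree_sum V P ((z, a, 3/2) # (z, b, 3/2) # (a, b, 1/4) # es)"
proof -
  note perm = tree_sum_mset[OF assms(1)] and flip = tree_sum_flip[OF assms(1)]
    and par = tree_sum_parallel[OF assms(1)]
  let ?Z = "tree_sum (insert u V) P" and ?Y = "tree_sum V P"
  have ne: "a \<noteq> u" "b \<noteq> u" "z \<noteq> u" using assms(3-6) by auto
  have "?Z (triangle 1 a u z @ triangle 1 u b z @ es) =
      ?Z ((a, u, 1) # (z, u, 1) # (u, z, 1) # (u, b, 1) # (z, a, 1) # (b, z, 1) # es)"
    by (rule perm) (simp add: triangle_def)
  also have "\<dots> = ?Z ((u, a, 1) # (z, u, 1) # (u, z, 1) # (u, b, 1) # (z, a, 1) # (b, z, 1) # es)"
    by (rule flip)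
  also have "\<dots> = ?Z ((z, u, 1) # (u, z, 1) # (u, a, 1) # (u, b, 1) # (z, a, 1) # (b, z, 1) # es)"
    by (rule perm) simp
  also have "\<dots> = ?Z ((u, z, 1) # (u, z, 1) # (u, a, 1) # (u, b, 1) # (z, a, 1) # (b, z, 1) # es)"
    by (rule flip)
  also have "\<dots> = ?Z ((u, z, 1 + 1) # (u, a, 1) # (u, b, 1) # (z, a, 1) # (b, z, 1) # es)"
    by (rule par)
  also have "\<dots> = 4 * ?Y ((z, a, (1 + 1) * 1 / 4) # (a, b, 1 * 1 / 4) # (b, z, 1 * (1 + 1) / 4) #
      (z, a, 1) # (b, z, 1) # es)"
    by (rule star_triangle) (use assms ne in auto)
  also have "\<dots> = 4 * ?Y ((z, a, 1/2) # (z, a, 1) # (b, z, 1/2) # (b, z, 1) # (a, b, 1/4) # es)"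
    by (rule arg_cong[of _ _ "(*) 4"], rule perm) simp
  also have "\<dots> = 4 * ?Y ((z, a, 1/2 + 1) # (b, z, 1/2) # (b, z, 1) # (a, b, 1/4) # es)"
    by (rule arg_cong[of _ _ "(*) 4"], rule par)
  also have "\<dots> = 4 * ?Y ((b, z, 1/2) # (b, z, 1) # (z, a, 1/2 + 1) # (a, b, 1/4) # es)"
    by (rule arg_cong[of _ _ "(*) 4"], rule perm) simp
  also have "\<dots> = 4 * ?Y ((b, z, 1/2 + 1) # (z, a, 1/2 + 1) # (a, b, 1/4) # es)"
    by (rule arg_cong[of _ _ "(*) 4"], rule par)
  also have "\<dots> = 4 * ?Y ((z, b, 1/2 + 1) # (z, a, 1/2 + 1) # (a, b, 1/4) # es)"
    by (rule arg_cong[of _ _ "(*) 4"], rule flip)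
  also have "\<dots> = 4 * ?Y ((z, a, 3/2) # (z, b, 3/2) # (a, b, 1/4) # es)"
    by (rule arg_cong[of _ _ "(*) 4"], rule perm) simp
  finally show ?thesis .
qed

text \<open>Each corner receives weight \<open>3/2\<close> towards \<open>z\<close> from each of its
  two neighbouring midpoints, hence \<open>3\<close> in all. The remaining star at \<open>z\<close>
  has weights \<open>3, 3, 3\<close> with sum \<open>9\<close> and becomes a unit triangle, which is
  added to the \<open>1/4\<close> left on each side by its midpoint. The total factor is
  \<open>4^3 * 9 = 576\<close>.\<close>

lemma subdivided_triangle:
  assumes "equivp P" "\<And>y x. y \<in> {u, v, t, z} \<Longrightarrow> P y x \<Longrightarrow> x = y"
    and "distinct [u, v, t, z]" "{u, v, t, z} \<inter> V = {}" "{a, b, c} \<subseteq> V"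
    and es: "\<And>e. e \<in> set es \<Longrightarrow> fst e \<notin> {u, v, t, z} \<and> fst (snd e) \<notin> {u, v, t, z}"
  shows "tree_sum (V \<union> {u, v, t, z}) P
      (triangle 1 a u z @ triangle 1 u b z @ triangle 1 b v z @ triangle 1 v c z @
       triangle 1 c t z @ triangle 1 t a z @ es) =
    576 * tree_sum V P (triangle (5/4) a b c @ es)"
proof -
  note perm = tree_sum_mset[OF assms(1)] and par = tree_sum_parallel[OF assms(1)]
  let ?W = "insert z V"
  have iso: "P u x \<Longrightarrow> x = u" "P v x \<Longrightarrow> x = v" "P t x \<Longrightarrow> x = t" "P z x \<Longrightarrow> x = z" for x
    using assms(2)[of _ x] by simp_all
  have dist: "u \<noteq> v" "u \<noteq> t" "u \<noteq> z" "v \<noteq> u" "v \<noteq> t" "v \<noteq> z" "t \<noteq> u" "t \<noteq> v" "t \<noteq> z"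
    "z \<noteq> u" "z \<noteq> v" "z \<noteq> t"
    using assms(3) by auto
  have V: "u \<notin> V" "v \<notin> V" "t \<notin> V" "z \<notin> V" "a \<in> V" "b \<in> V" "c \<in> V"
    using assms(4,5) by auto
  have ne: "a \<noteq> u" "a \<noteq> v" "a \<noteq> t" "a \<noteq> z" "b \<noteq> u" "b \<noteq> v" "b \<noteq> t" "b \<noteq> z"
    "c \<noteq> u" "c \<noteq> v" "c \<noteq> t" "c \<noteq> z"
    using V by auto
  note ne = ne dist ne[symmetric]
  have es': "(u, x, w) \<notin> set es" "(x, u, w) \<notin> set es" "(v, x, w) \<notin> set es" "(x, v, w) \<notin> set es"
    "(t, x, w) \<notin> set es" "(x, t, w) \<notin> set es" "(z, x, w) \<notin> set es" "(x, z, w) \<notin> set es" for x w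
    by (auto dest: es)
  have "V \<union> {u, v, t, z} = insert u (insert v (insert t ?W))" by auto
  then have "tree_sum (V \<union> {u, v, t, z}) P
      (triangle 1 a u z @ triangle 1 u b z @ triangle 1 b v z @ triangle 1 v c z @
       triangle 1 c t z @ triangle 1 t a z @ es) =
     tree_sum (insert u (insert v (insert t ?W))) P
      (triangle 1 a u z @ triangle 1 u b z @ triangle 1 b v z @ triangle 1 v c z @
       triangle 1 c t z @ triangle 1 t a z @ es)" by simp
  also have "\<dots> = 4 * tree_sum (insert v (insert t ?W)) P ((z, a, 3/2) # (z, b, 3/2) # (a, b, 1/4) #
      triangle 1 b v z @ triangle 1 v c z @ triangle 1 c t z @ triangle 1 t a z @ es)"
    by (rule eliminate_midpoint[OF assms(1) iso(1)]) (use V dist in \<open>auto simp: triangle_def ne es'\<close>)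
  also have "tree_sum (insert v (insert t ?W)) P ((z, a, 3/2) # (z, b, 3/2) # (a, b, 1/4) #
      triangle 1 b v z @ triangle 1 v c z @ triangle 1 c t z @ triangle 1 t a z @ es) =
     tree_sum (insert v (insert t ?W)) P (triangle 1 b v z @ triangle 1 v c z @
      (z, a, 3/2) # (z, b, 3/2) # (a, b, 1/4) # triangle 1 c t z @ triangle 1 t a z @ es)"
    by (rule perm) simp
  also have "\<dots> = 4 * tree_sum (insert t ?W) P ((z, b, 3/2) # (z, c, 3/2) # (b, c, 1/4) #
      (z, a, 3/2) # (z, b, 3/2) # (a, b, 1/4) # triangle 1 c t z @ triangle 1 t a z @ es)"
    by (rule eliminate_midpoint[OF assms(1) iso(2)]) (use V dist in \<open>auto simp: triangle_def ne es'\<close>)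
  also have "tree_sum (insert t ?W) P ((z, b, 3/2) # (z, c, 3/2) # (b, c, 1/4) #
      (z, a, 3/2) # (z, b, 3/2) # (a, b, 1/4) # triangle 1 c t z @ triangle 1 t a z @ es) =
     tree_sum (insert t ?W) P (triangle 1 c t z @ triangle 1 t a z @ (z, b, 3/2) # (z, c, 3/2) #
      (b, c, 1/4) # (z, a, 3/2) # (z, b, 3/2) # (a, b, 1/4) # es)"
    by (rule perm) simp
  also have "\<dots> = 4 * tree_sum ?W P ((z, c, 3/2) # (z, a, 3/2) # (c, a, 1/4) # (z, b, 3/2) #
      (z, c, 3/2) # (b, c, 1/4) # (z, a, 3/2) # (z, b, 3/2) # (a, b, 1/4) # es)"
    by (rule eliminate_midpoint[OF assms(1) iso(3)]) (use V dist in \<open>auto simp: triangle_def ne es'\<close>)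
  also have "tree_sum ?W P ((z, c, 3/2) # (z, a, 3/2) # (c, a, 1/4) # (z, b, 3/2) #
      (z, c, 3/2) # (b, c, 1/4) # (z, a, 3/2) # (z, b, 3/2) # (a, b, 1/4) # es) =
     tree_sum ?W P ((z, a, 3/2) # (z, a, 3/2) # (z, b, 3/2) # (z, b, 3/2) # (z, c, 3/2) # (z, c, 3/2) #
      (a, b, 1/4) # (b, c, 1/4) # (c, a, 1/4) # es)"
    by (rule perm) simp
  also have "\<dots> = tree_sum ?W P ((z, a, 3/2 + 3/2) # (z, b, 3/2) # (z, b, 3/2) # (z, c, 3/2) #
      (z, c, 3/2) # (a, b, 1/4) # (b, c, 1/4) # (c, a, 1/4) # es)"
    by (rule par)
  also have "\<dots> = tree_sum ?W P ((z, b, 3/2) # (z, b, 3/2) # (z, c, 3/2) #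
      (z, c, 3/2) # (z, a, 3) # (a, b, 1/4) # (b, c, 1/4) # (c, a, 1/4) # es)"
    by (rule perm) simp
  also have "\<dots> = tree_sum ?W P ((z, b, 3/2 + 3/2) # (z, c, 3/2) #
      (z, c, 3/2) # (z, a, 3) # (a, b, 1/4) # (b, c, 1/4) # (c, a, 1/4) # es)"
    by (rule par)
  also have "\<dots> = tree_sum ?W P ((z, c, 3/2) #
      (z, c, 3/2) # (z, a, 3) # (z, b, 3) # (a, b, 1/4) # (b, c, 1/4) # (c, a, 1/4) # es)"
    by (rule perm) simp
  also have "\<dots> = tree_sum ?W P ((z, c, 3/2 + 3/2) #
      (z, a, 3) # (z, b, 3) # (a, b, 1/4) # (b, c, 1/4) # (c, a, 1/4) # es)"
    by (rule par)
  also have "\<dots> = tree_sum ?W P ((z, a, 3) # (z, b, 3) # (z, c, 3) #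
      (a, b, 1/4) # (b, c, 1/4) # (c, a, 1/4) # es)"
    by (rule perm) simp
  also have "\<dots> = 9 * tree_sum V P ((a, b, 3 * 3 / 9) # (b, c, 3 * 3 / 9) # (c, a, 3 * 3 / 9) #
      (a, b, 1/4) # (b, c, 1/4) # (c, a, 1/4) # es)"
    by (rule star_triangle[OF assms(1) iso(4)]) (use V in \<open>auto simp: ne es'\<close>)
  also have "tree_sum V P ((a, b, 3 * 3 / 9) # (b, c, 3 * 3 / 9) # (c, a, 3 * 3 / 9) #
      (a, b, 1/4) # (b, c, 1/4) # (c, a, 1/4) # es) =
     tree_sum V P ((a, b, 1) # (a, b, 1/4) # (b, c, 1) # (b, c, 1/4) # (c, a, 1) # (c, a, 1/4) # es)"
    by (rule perm) simp
  also have "\<dots> = tree_sum V P ((a, b, 1 + 1/4) # (b, c, 1) # (b, c, 1/4) # (c, a, 1) # (c, a, 1/4) # es)"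
    by (rule par)
  also have "\<dots> = tree_sum V P ((b, c, 1) # (b, c, 1/4) # (c, a, 1) # (c, a, 1/4) # (a, b, 5/4) # es)"
    by (rule perm) simp
  also have "\<dots> = tree_sum V P ((b, c, 1 + 1/4) # (c, a, 1) # (c, a, 1/4) # (a, b, 5/4) # es)"
    by (rule par)
  also have "\<dots> = tree_sum V P ((c, a, 1) # (c, a, 1/4) # (a, b, 5/4) # (b, c, 5/4) # es)"
    by (rule perm) simp
  also have "\<dots> = tree_sum V P ((c, a, 1 + 1/4) # (a, b, 5/4) # (b, c, 5/4) # es)"
    by (rule par)
  also have "\<dots> = tree_sum V P (triangle (5/4) a b c @ es)"
    by (rule perm) (simp add: triangle_def)
  finally show ?thesis by linarith
qed

text \<open>Every term that passes the final test has contracted exactly \<open>m\<close> edges,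
  since each contraction lowers the number of classes by one, from \<open>Suc m\<close> to a single
  class. The map \<open>f\<close> labels the classes of \<open>P\<close> on \<open>V\<close>, so
  that they are counted by the size of an image.\<close>

lemma tree_sum_scale:
  fixes f :: "'v \<Rightarrow> 'a"
  assumes "finite V" "card (f ` V) = Suc m"
    and "\<And>x y. x \<in> V \<Longrightarrow> y \<in> V \<Longrightarrow> P x y = (f x = f y)"
    and "\<And>u v w. (u, v, w) \<in> set es \<Longrightarrow> u \<in> V \<and> v \<in> V"
  shows "tree_sum V P (map (\<lambda>(u, v, w). (u, v, k * w)) es) = k ^ m * tree_sum V P es"
  using assms(2-)
proof (induction es arbitrary: f P m)
  case Nil
  show ?case
  proof (cases "\<forall>x\<in>V. \<forall>y\<in>V. P x y")
    case True
    have "V \<noteq> {}" using Nil.prems(1) by auto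
    then obtain z where z: "z \<in> V" by blast
    have "f x = f z" if "x \<in> V" for x using True Nil.prems(2)[OF that z] that z by simp
    then have "f ` V = (\<lambda>x. f z) ` V" by (rule image_cong[OF refl])
    then have "f ` V = {f z}" using z by auto
    then show ?thesis using Nil.prems(1) by simp
  qed auto
next
  case (Cons e es)
  obtain u v w where e: "e = (u, v, w)" by (cases e)
  have uv: "u \<in> V" "v \<in> V" using Cons.prems(3)[of u v w] by (auto simp: e)
  have es: "u \<in> V \<and> v \<in> V" if "(u, v, w) \<in> set es" for u v w
    using Cons.prems(3)[of u v w] that by simp
  have IH0: "tree_sum V P (map (\<lambda>(u, v, w). (u, v, k * w)) es) = k ^ m * tree_sum V P es"
    by (rule Cons.IH[OF Cons.prems(1,2) es])
  show ?case
  proof (cases "P u v")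
    case True
    then show ?thesis using IH0 by (simp add: e)
  next
    case False
    then have fuv: "f u \<noteq> f v" using Cons.prems(2)[OF uv] by simp
    \<comment> \<open>\<open>g\<close> gives the class of \<open>u\<close> the label of
      \<open>v\<close>, so exactly one label disappears.\<close>
    define g where "g x = (if f x = f u then f v else f x)" for x
    have g: "g ` V = f ` V - {f u}"
      using fuv uv by (auto simp: g_def)
    then have "card (g ` V) = m" using Cons.prems(1) uv assms(1) by simp
    \<comment> \<open>The label of \<open>v\<close> survives, which excludes
      \<open>m = 0\<close>.\<close>
    moreover have "card (g ` V) > 0" using uv(2) assms(1) by (auto simp: card_gt_0_iff)
    ultimately obtain m' where m': "m = Suc m'" "card (g ` V) = Suc m'" by (cases m) auto
    have J: "join P u v x y = (g x = g y)" if "x \<in> V" "y \<in> V" for x y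
      using fuv unfolding join_def g_def
      by (auto simp: Cons.prems(2)[OF that] Cons.prems(2)[OF that(1) uv(1)] Cons.prems(2)[OF that(1) uv(2)]
        Cons.prems(2)[OF uv(1) that(2)] Cons.prems(2)[OF uv(2) that(2)])
    have "tree_sum V (join P u v) (map (\<lambda>(u, v, w). (u, v, k * w)) es) =
        k ^ m' * tree_sum V (join P u v) es"
      by (rule Cons.IH[OF m'(2) J es])
    then show ?thesis using IH0 False m'(1) by (simp add: e distrib_left)
  qed
qed

section \<open>Spanning trees and tree sums\<close>

text \<open>Connectivity by the edges of \<open>T\<close> where steps within \<open>P\<close> are
  free, that is, connectivity after the edges recorded in \<open>P\<close> have been
  contracted.\<close>

definition linked :: "('e \<Rightarrow> 'v set) \<Rightarrow> ('v \<Rightarrow> 'v \<Rightarrow> bool) \<Rightarrow> 'e set \<Rightarrow> 'v \<Rightarrow> 'v \<Rightarrow> bool" where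
  "linked en P T = (\<lambda>x y. P x y \<or> (\<exists>e\<in>T. en e = {x, y}))\<^sup>*\<^sup>*"

text \<open>Acyclicity is phrased as: every edge is a bridge.\<close>

definition spans :: "('e \<Rightarrow> 'v set) \<Rightarrow> 'v set \<Rightarrow> ('v \<Rightarrow> 'v \<Rightarrow> bool) \<Rightarrow> 'e set \<Rightarrow> bool" where
  "spans en V P T \<longleftrightarrow> (\<forall>x\<in>V. \<forall>y\<in>V. linked en P T x y) \<and>
     (\<forall>e\<in>T. \<forall>x y. en e = {x, y} \<longrightarrow> \<not> linked en P (T - {e}) x y)"

lemma linked_base: "P x y \<Longrightarrow> linked en P T x y"
  unfolding linked_def by (rule r_into_rtranclp) simp

lemma linked_edge: "e \<in> T \<Longrightarrow> en e = {x, y} \<Longrightarrow> linked en P T x y"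
  unfolding linked_def by (rule r_into_rtranclp) blast

lemma equivp_linked:
  assumes "equivp P"
  shows "equivp (linked en P T)"
proof (rule equivpI)
  show "reflp (linked en P T)" by (simp add: linked_def reflp_def)
  have "symp (\<lambda>x y. P x y \<or> (\<exists>e\<in>T. en e = {x, y}))"
    using equivp_symp[OF assms] by (auto simp: symp_def insert_commute)
  then show "symp (linked en P T)" unfolding linked_def by (rule symp_rtranclp)
  show "transp (linked en P T)" by (auto simp: linked_def transp_def)
qed

lemma linked_least:
  assumes "equivp Q" "\<And>x y. P x y \<Longrightarrow> Q x y" "\<And>e x y. e \<in> T \<Longrightarrow> en e = {x, y} \<Longrightarrow> Q x y"
    and "linked en P T x y"
  shows "Q x y"
  using assms(4) unfolding linked_def
proof (induction rule: rtranclp_induct)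
  case base
  show ?case using equivp_reflp[OF assms(1)] .
next
  case (step y z)
  then have "Q y z" using assms(2,3) by blast
  then show ?case using step.IH equivp_transp[OF assms(1)] by blast
qed

lemma linked_empty:
  assumes "equivp P"
  shows "linked en P {} = P"
proof (intro ext iffI)
  show "P x y" if "linked en P {} x y" for x y
    by (rule linked_least[OF assms _ _ that]) auto
qed (rule linked_base)

lemma linked_mono: "T \<subseteq> T' \<Longrightarrow> linked en P T x y \<Longrightarrow> linked en P T' x y"
  unfolding linked_def by (erule rtranclp_mono[THEN predicate2D, rotated]) blast

lemma equivp_doubleton:
  assumes "equivp Q" "Q u v" "{u, v} = {x, y}"
  shows "Q x y"
  using assms(2,3) equivp_symp[OF assms(1), of u v] by (auto simp: doubleton_eq_iff)

lemma linked_insert: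
  assumes "equivp P" "en e = {u, v}"
  shows "linked en P (insert e T) = join (linked en P T) u v"
proof (intro ext iffI)
  have E: "equivp (join (linked en P T) u v)"
    by (intro equivp_join equivp_linked assms(1))
  show "join (linked en P T) u v x y" if "linked en P (insert e T) x y" for x y
  proof (rule linked_least[OF E _ _ that])
    show "join (linked en P T) u v x y" if "P x y" for x y
      by (intro join_mono linked_base that)
    show "join (linked en P T) u v x y" if "f \<in> insert e T" "en f = {x, y}" for f x y
    proof (cases "f = e")
      case True
      then show ?thesis
        using equivp_doubleton[OF E join_edge[OF equivp_linked[OF assms(1)]]] assms(2) that(2) by simp
    next
      case False
      then show ?thesis using that by (intro join_mono linked_edge[of f]) auto
    qed
  qed
  show "linked en P (insert e T) x y" if "join (linked en P T) u v x y" for x y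
  proof (rule join_least[OF equivp_linked[OF assms(1)] _ _ that])
    show "linked en P (insert e T) x y" if "linked en P T x y" for x y
      by (rule linked_mono[OF _ that]) auto
    show "linked en P (insert e T) u v" by (rule linked_edge[of e]) (simp_all add: assms(2))
  qed
qed

text \<open>Contracting \<open>e\<close> beforehand and keeping it as an edge generate the same
  least equivalence. This is what lets \<open>join\<close> in \<open>tree_sum\<close> stand for an
  edge chosen into the tree.\<close>

lemma linked_join:
  assumes "equivp P" "en e = {u, v}"
  shows "linked en (join P u v) T = linked en P (insert e T)"
proof (intro ext iffI)
  have uv: "linked en P (insert e T) u v" by (rule linked_edge[of e]) (simp_all add: assms(2))
  show "linked en P (insert e T) x y" if "linked en (join P u v) T x y" for x y
  proof (rule linked_least[OF equivp_linked[OF assms(1)] _ _ that])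
    show "linked en P (insert e T) x y" if "join P u v x y" for x y
      by (rule join_least[OF equivp_linked[OF assms(1)] _ uv that]) (rule linked_base)
    show "linked en P (insert e T) x y" if "f \<in> T" "en f = {x, y}" for f x y
      by (rule linked_edge[of f]) (simp_all add: that)
  qed
  have luv: "linked en (join P u v) T u v"
    by (intro linked_base join_edge assms(1))
  have E: "equivp (linked en (join P u v) T)"
    by (intro equivp_join equivp_linked assms(1))
  show "linked en (join P u v) T x y" if "linked en P (insert e T) x y" for x y
  proof (rule linked_least[OF E _ _ that])
    show "linked en (join P u v) T x y" if "P x y" for x y
      by (intro join_mono linked_base that)
    show "linked en (join P u v) T x y" if "f \<in> insert e T" "en f = {x, y}" for f x y
    proof (cases "f = e")
      case True
      then show ?thesis
        using equivp_doubleton[OF E luv] assms(2) that(2) by simp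
    next
      case False
      then show ?thesis using that by (intro linked_edge[of f]) auto
    qed
  qed
qed

text \<open>Add the edges of \<open>T\<close> one at a time and suppose that \<open>f\<close> is the
  first to link \<open>u\<close> with \<open>v\<close>. Then \<open>e\<close> and the earlier edges
  link the ends of \<open>f\<close>, so \<open>f\<close> is not a bridge in the presence of
  \<open>e\<close>.\<close>

lemma not_linked_exchange:
  assumes "equivp P" "en e = {u, v}" "\<not> P u v" "finite T" "e \<notin> T"
    and "\<And>f x y. f \<in> T \<Longrightarrow> en f = {x, y} \<Longrightarrow> \<not> linked en P (insert e (T - {f})) x y"
    and "\<And>f. f \<in> T \<Longrightarrow> \<exists>x y. en f = {x, y}"
  shows "\<not> linked en P T u v"
  using assms(4-)
proof (induction T rule: finite_induct)
  case empty
  then show ?case by (simp add: linked_empty assms)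
next
  case (insert f T)
  obtain x y where xy: "en f = {x, y}" using insert.prems(3) by blast
  have "\<not> linked en P T u v"
  proof (rule insert.IH)
    show "\<not> linked en P (insert e (T - {g})) x y" if "g \<in> T" "en g = {x, y}" for g x y
    proof
      assume "linked en P (insert e (T - {g})) x y"
      then have "linked en P (insert e (insert f T - {g})) x y"
        by (rule linked_mono[rotated]) auto
      then show False using insert.prems(2)[of g x y] that by simp
    qed
  qed (use insert.prems in auto)
  moreover have "\<not> linked en P (insert e (insert f T - {f})) x y"
    by (rule insert.prems(2)) (simp_all add: xy)
  then have "\<not> join (linked en P T) u v x y"
    using insert.hyps(2) linked_insert[of P en e u v T, OF assms(1,2)] by simp
  \<comment> \<open>As \<open>u\<close> and \<open>v\<close> are not yet linked, a join along
    \<open>x\<close>, \<open>y\<close> that links them can be reversed: the join along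
    \<open>u\<close>, \<open>v\<close> then links \<open>x\<close> with \<open>y\<close>.\<close>
  ultimately have "\<not> join (linked en P T) x y u v"
    using equivp_symp[OF equivp_linked[OF assms(1), of en T]] unfolding join_def by blast
  then show ?case using linked_insert[of P en f x y T, OF assms(1) xy] by simp
qed

text \<open>By \<open>linked_join\<close>, connectivity and the bridge conditions at the other edges
  become those of the contracted problem. Given these, the bridge condition at \<open>e\<close>
  itself amounts to \<open>e\<close> not being a loop, by the exchange argument.\<close>

lemma spans_insert:
  assumes "equivp P" "en e = {u, v}" "finite T" "e \<notin> T"
    and "\<And>f. f \<in> T \<Longrightarrow> \<exists>x y. en f = {x, y}"
  shows "spans en V P (insert e T) \<longleftrightarrow> \<not> P u v \<and> spans en V (join P u v) T"
proof -
  note LJ = linked_join[OF assms(1), of en e, OF assms(2)]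
  have diff: "insert e T - {f} = insert e (T - {f})" if "f \<in> T" for f
    using that assms(4) by auto
  have "\<not> linked en P T u v" if "\<not> P u v"
    "\<And>f x y. f \<in> T \<Longrightarrow> en f = {x, y} \<Longrightarrow> \<not> linked en P (insert e (T - {f})) x y"
    using not_linked_exchange[OF assms(1,2) that(1) assms(3,4) that(2) assms(5)] .
  moreover have "\<not> P u v" if "\<not> linked en P T u v" using linked_base that by metis
  moreover have "(\<forall>x y. en e = {x, y} \<longrightarrow> \<not> linked en P (insert e T - {e}) x y) = (\<not> linked en P T u v)"
    using assms(2,4) equivp_doubleton[OF equivp_linked[OF assms(1)], of en T] by (auto 0 3)
  ultimately show ?thesis
    unfolding spans_def LJ by (auto simp: diff)
qed

text \<open>The edge sets without and with the first edge correspond to the deletion and the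
  contraction term of \<open>tree_sum\<close>, and unit weights turn the sum into a count. Parallel
  edges are told apart by their labels in \<open>xs\<close>, even where their entries in
  \<open>ys\<close> coincide.\<close>

lemma card_spans:
  assumes "list_all2 (\<lambda>e (u, v, w). en e = {u, v} \<and> w = 1) xs ys" "distinct xs" "equivp P"
  shows "real (card {T. T \<subseteq> set xs \<and> spans en V P T}) = tree_sum V P ys"
  using assms
proof (induction arbitrary: P rule: list_all2_induct)
  case Nil
  have "{T. T \<subseteq> set [] \<and> spans en V P T} = (if \<forall>x\<in>V. \<forall>y\<in>V. P x y then {{}} else {})"
    by (auto simp: spans_def linked_empty[OF Nil(2)])
  then show ?case by simp
next
  case (Cons e xs f ys)
  obtain u v where f: "f = (u, v, 1)" "en e = {u, v}" using Cons.hyps(1) by (cases f) auto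
  have en: "\<exists>x y. en g = {x, y}" if g: "g \<in> set xs" for g
  proof -
    obtain i where "i < length xs" "g = xs ! i" using g by (auto simp: in_set_conv_nth)
    then show ?thesis
      using list_all2_nthD[OF Cons.hyps(2), of i] by (cases "ys ! i") auto
  qed
  let ?A = "\<lambda>P. {T. T \<subseteq> set xs \<and> spans en V P T}"
  have e: "e \<notin> set xs" and d: "distinct xs" using Cons.prems by auto
  have S: "spans en V P (insert e T) \<longleftrightarrow> \<not> P u v \<and> spans en V (join P u v) T" if "T \<subseteq> set xs" for T
    by (rule spans_insert[of P en e, OF Cons.prems(2) f(2)]) (use that e en finite_subset[OF that] in auto)
  have fin: "finite (?A P)" for P by (rule finite_subset[of _ "Pow (set xs)"]) auto
  have "{T. T \<subseteq> set (e # xs) \<and> spans en V P T} =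
      ?A P \<union> insert e ` {T. T \<subseteq> set xs \<and> spans en V P (insert e T)}" (is "_ = _ \<union> ?I")
  proof (intro equalityI subsetI)
    fix T assume T: "T \<in> {T. T \<subseteq> set (e # xs) \<and> spans en V P T}"
    show "T \<in> ?A P \<union> ?I"
    proof (cases "e \<in> T")
      case True
      then have "T = insert e (T - {e})" by auto
      moreover have "T - {e} \<subseteq> set xs" using T by auto
      ultimately show ?thesis using T by (intro UnI2 image_eqI[of _ _ "T - {e}"]) auto
    qed (use T in auto)
  qed auto
  moreover have "?A P \<inter> ?I = {}" using e by auto
  moreover have I: "?I = (if P u v then {} else insert e ` ?A (join P u v))"
    using S by auto
  moreover have "card (insert e ` ?A Q) = card (?A Q)" for Q
    by (rule card_image) (use e in \<open>auto intro!: inj_onI simp: insert_ident\<close>)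
  ultimately have "card {T. T \<subseteq> set (e # xs) \<and> spans en V P T} =
      card (?A P) + (if P u v then 0 else card (?A (join P u v)))"
    using fin by (simp add: card_Un_disjoint)
  then show ?case
    using Cons.IH[OF d Cons.prems(2)] Cons.IH[OF d equivp_join[OF Cons.prems(2)]] by (simp add: f(1))
qed


section \<open>Cycles and bridges\<close>

lemma cycle_not_spans:
  assumes "is_cycle (G\<lparr>edges := T\<rparr>) vs es"
  shows "\<not> spans (ends G) V P T"
proof -
  define n where "n = length vs - 1"
  have n: "length vs = Suc n" "length es = Suc n" "distinct es" "set es \<subseteq> T"
    using assms by (auto simp: is_cycle_def n_def)
  have ends: "ends G (es ! i) = {vs ! i, vs ! (Suc i mod Suc n)}" if "i \<le> n" for i
    using assms that n(1) by (auto simp: is_cycle_def)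
  \<comment> \<open>The closing edge is no bridge, because the rest of the cycle links its ends. For
    a loop \<open>n = 0\<close> and the linking path is empty.\<close>
  let ?e = "es ! n"
  have "linked (ends G) P (T - {?e}) (vs ! 0) (vs ! i)" if "i \<le> n" for i
    using that
  proof (induction i)
    case 0
    show ?case by (simp add: linked_def)
  next
    case (Suc i)
    have "es ! i \<noteq> ?e" using Suc.prems n by (simp add: nth_eq_iff_index_eq)
    then have "es ! i \<in> T - {?e}" using n Suc.prems by (auto dest: nth_mem)
    moreover have "ends G (es ! i) = {vs ! i, vs ! Suc i}" using ends[of i] Suc.prems by simp
    ultimately have "linked (ends G) P (T - {?e}) (vs ! i) (vs ! Suc i)" by (rule linked_edge)
    then show ?case using Suc.IH Suc.prems by (auto simp: linked_def)
  qed
  then have "linked (ends G) P (T - {?e}) (vs ! 0) (vs ! n)" by simp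
  moreover have "ends G ?e = {vs ! 0, vs ! n}" using ends[of n] by auto
  moreover have "?e \<in> T" using n by (auto dest: nth_mem)
  ultimately show ?thesis unfolding spans_def by blast
qed

lemma rtranclp_simple_path:
  assumes "R\<^sup>*\<^sup>* x y"
  obtains vs where "vs \<noteq> []" "hd vs = x" "last vs = y" "distinct vs" "successively R vs"
proof -
  have "\<exists>vs. vs \<noteq> [] \<and> hd vs = x \<and> last vs = y \<and> distinct vs \<and> successively R vs"
    using assms
  proof (induction rule: rtranclp_induct)
    case base
    show ?case by (rule exI[of _ "[x]"]) simp
  next
    case (step y z)
    then obtain vs where vs: "vs \<noteq> []" "hd vs = x" "last vs = y" "distinct vs" "successively R vs"
      by blast
    show ?case
    proof (cases "z \<in> set vs")
      case True
      \<comment> \<open>A step back to a vertex \<open>z\<close> of the path is handled by cutting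
        the path at \<open>z\<close>.\<close>
      then obtain p q where pq: "vs = p @ z # q" by (meson split_list)
      have "hd (p @ [z]) = x" using vs(2) unfolding pq by (cases p) auto
      moreover have "distinct (p @ [z])" using vs(4) unfolding pq by auto
      moreover have "successively R (p @ [z])"
        using vs(5) unfolding pq by (auto simp: successively_append_iff)
      ultimately show ?thesis by (intro exI[of _ "p @ [z]"]) simp
    next
      case False
      then show ?thesis using vs step.hyps(2)
        by (intro exI[of _ "vs @ [z]"]) (auto simp: successively_append_iff)
    qed
  qed
  then show ?thesis using that by blast
qed

lemma linked_eq: "linked en (=) T = (\<lambda>x y. \<exists>e\<in>T. en e = {x, y})\<^sup>*\<^sup>*"
proof -
  have "(\<lambda>x y. x = y \<or> (\<exists>e\<in>T. en e = {x, y})) = (\<lambda>x y. \<exists>e\<in>T. en e = {x, y})\<^sup>=\<^sup>="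
    by auto
  then show ?thesis unfolding linked_def by (simp only: rtranclp_reflclp)
qed

text \<open>A simple path from \<open>x\<close> to \<open>y\<close> that avoids \<open>e\<close> is
  closed by \<open>e\<close> itself. If \<open>x = y\<close>, the path is a single vertex and the
  cycle a loop.\<close>

lemma ex_cycle:
  assumes "e \<in> T" "ends G e = {x, y}" "linked (ends G) (=) (T - {e}) x y"
    and "\<And>f. f \<in> T \<Longrightarrow> ends G f \<subseteq> vertices G"
  shows "\<exists>vs es. is_cycle (G\<lparr>edges := T\<rparr>) vs es"
proof -
  obtain vs where vs: "vs \<noteq> []" "hd vs = x" "last vs = y" "distinct vs"
    "successively (\<lambda>x y. \<exists>f\<in>T - {e}. ends G f = {x, y}) vs"
    using assms(3) unfolding linked_eq by (rule rtranclp_simple_path)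
  define n where "n = length vs - 1"
  have n: "length vs = Suc n" using vs(1) by (simp add: n_def)
  have "\<exists>f\<in>T - {e}. ends G f = {vs ! i, vs ! Suc i}" if "i < n" for i
    using successively_nth[OF vs(5), of i] that n by simp
  then obtain g where g: "\<And>i. i < n \<Longrightarrow> g i \<in> T - {e}"
    "\<And>i. i < n \<Longrightarrow> ends G (g i) = {vs ! i, vs ! Suc i}"
    by metis
  define es where "es = map g [0..<n] @ [e]"
  have len: "length es = Suc n" by (simp add: es_def)
  \<comment> \<open>On a path without repeated vertices different positions have different pairs of
    ends, so the chosen edges are distinct.\<close>
  have inj: "i = j" if "i < n" "j < n" "g i = g j" for i j
  proof -
    have "{vs ! i, vs ! Suc i} = {vs ! j, vs ! Suc j}" using that g(2) by metis
    then show ?thesis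
      using that vs(4) n by (auto simp: doubleton_eq_iff nth_eq_iff_index_eq)
  qed
  have "e \<notin> g ` {0..<n}" using g(1) by fastforce
  moreover have "inj_on g {0..<n}" by (rule inj_onI) (simp add: inj)
  ultimately have "distinct es" by (simp add: es_def distinct_map)
  have esT: "set es \<subseteq> T" using g(1) assms(1) by (auto simp: es_def)
  have ends: "ends G (es ! i) = {vs ! i, vs ! (Suc i mod length vs)}" if "i < Suc n" for i
  proof (cases "i = n")
    case True
    have "vs ! 0 = x" "vs ! n = y" using vs(1-3) n by (auto simp: hd_conv_nth last_conv_nth)
    then show ?thesis using True assms(2) n by (auto simp: es_def nth_append)
  next
    case False
    then show ?thesis using that g(2)[of i] n by (simp add: es_def nth_append)
  qed
  have "set vs \<subseteq> vertices G"
  proof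
    fix v assume "v \<in> set vs"
    then obtain i where i: "i < Suc n" "v = vs ! i" using n by (metis in_set_conv_nth)
    then have "v \<in> ends G (es ! i)" using ends by simp
    moreover have "es ! i \<in> T" using esT i len by (metis nth_mem subsetD)
    ultimately show "v \<in> vertices G" using assms(4) by blast
  qed
  then have "is_cycle (G\<lparr>edges := T\<rparr>) vs es"
    unfolding is_cycle_def using vs(1,4) n len \<open>distinct es\<close> esT ends by simp
  then show ?thesis by blast
qed

lemma is_tree_iff_spans:
  assumes "vertices G \<noteq> {}" "\<And>f. f \<in> T \<Longrightarrow> ends G f \<subseteq> vertices G"
  shows "is_tree (G\<lparr>edges := T\<rparr>) \<longleftrightarrow> spans (ends G) (vertices G) (=) T"
proof -
  have rt: "(x, y) \<in> {(x, y). \<exists>e\<in>T. ends G e = {x, y}}\<^sup>* \<longleftrightarrow> linked (ends G) (=) T x y" for x y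
    unfolding linked_eq by (simp add: rtranclp_rtrancl_eq)
  have "connected_graph (G\<lparr>edges := T\<rparr>) \<longleftrightarrow>
      (\<forall>x\<in>vertices G. \<forall>y\<in>vertices G. linked (ends G) (=) T x y)"
    unfolding connected_graph_def using assms(1) rt by simp
  \<comment> \<open>A cycle refutes \<open>spans\<close> only as a whole; connectivity is assumed
    here to place the failure in the bridge clause.\<close>
  moreover have "(\<nexists>vs es. is_cycle (G\<lparr>edges := T\<rparr>) vs es) \<longleftrightarrow>
      (\<forall>e\<in>T. \<forall>x y. ends G e = {x, y} \<longrightarrow> \<not> linked (ends G) (=) (T - {e}) x y)"
    if "\<forall>x\<in>vertices G. \<forall>y\<in>vertices G. linked (ends G) (=) T x y"
    using ex_cycle[OF _ _ _ assms(2)] cycle_not_spans[where G = G and T = T and V = "vertices G" and P = "(=)"] that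
    unfolding spans_def by blast
  ultimately show ?thesis unfolding is_tree_def spans_def by blast
qed

lemma tau_tree_sum:
  assumes "list_all2 (\<lambda>e (u, v, w). ends G e = {u, v} \<and> w = 1) xs ys" "distinct xs"
    and "set xs = edges G" "vertices G \<noteq> {}" "\<And>f. f \<in> edges G \<Longrightarrow> ends G f \<subseteq> vertices G"
  shows "real (tau G) = tree_sum (vertices G) (=) ys"
proof -
  have "spanning_trees G = {T. T \<subseteq> set xs \<and> spans (ends G) (vertices G) (=) T}"
    unfolding spanning_trees_def using is_tree_iff_spans[OF assms(4)] assms(3,5) by blast
  then show ?thesis
    unfolding tau_def using card_spans[OF assms(1,2) identity_equivp] by simp
qed

section \<open>The gasket graphs\<close>

fun cell_edges :: "real \<Rightarrow> cell \<Rightarrow> (vertex \<times> vertex \<times> real) list" where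
  "cell_edges w (Cell a b c) = triangle w a b c"

text \<open>The sides come in the order of \<open>cell_edges\<close>, so labelled edges and weighted
  triples match position by position.\<close>

fun side_list :: "cell \<Rightarrow> (cell \<times> vertex set) list" where
  "side_list (Cell a b c) = map (Pair (Cell a b c)) [{a, b}, {b, c}, {c, a}]"

fun subdivide_list :: "cell \<Rightarrow> cell list" where
  "subdivide_list (Cell a b c) =
     (let C = Cell a b c; o' = Bary C in
       [Cell a (Mid C a b) o', Cell (Mid C a b) b o',
        Cell b (Mid C b c) o', Cell (Mid C b c) c o',
        Cell c (Mid C c a) o', Cell (Mid C c a) a o'])"

fun new_vertices :: "cell \<Rightarrow> vertex set" where
  "new_vertices (Cell a b c) =
     (let C = Cell a b c in {Mid C a b, Mid C b c, Mid C c a, Bary C})"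

primrec cell_list :: "nat \<Rightarrow> cell list" where
  "cell_list 0 = [Cell (Corner 1) (Corner 2) (Corner 3)]"
| "cell_list (Suc n) = concat (map subdivide_list (cell_list n))"

section \<open>Cell lists and vertex counts\<close>

lemma set_subdivide_list: "set (subdivide_list C) = subdivide C"
  by (cases C) (simp add: Let_def)

lemma set_cell_list: "set (cell_list n) = cells n"
  by (induction n) (simp_all add: set_subdivide_list)

lemma length_cell_list: "length (cell_list n) = 6 ^ n"
proof (induction n)
  case (Suc n)
  have "length (subdivide_list C) = 6" for C by (cases C) (simp add: Let_def)
  then show ?case using Suc by (simp add: length_concat comp_def sum_list_triv)
qed simp

lemma distinct_cell_list: "distinct (cell_list n)"
  by (rule card_distinct) (simp add: set_cell_list length_cell_list card_cells)

lemma new_vertices_origin: "v \<in> new_vertices C \<Longrightarrow> v = Bary C \<or> (\<exists>x y. v = Mid C x y)"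
  by (cases C) (auto simp: Let_def)

lemma disjoint_new_vertices: "C \<noteq> D \<Longrightarrow> new_vertices C \<inter> new_vertices D = {}"
  using new_vertices_origin by blast

lemma new_vertices_disjoint_gasket:
  "C \<in> cells n \<Longrightarrow> new_vertices C \<inter> vertices (gasket_graph n) = {}"
  using new_vertices_origin new_vertices_fresh by blast

lemma card_new_vertices:
  assumes "C \<in> cells n"
  shows "card (new_vertices C) = 4"
  using assms by (cases C) (auto dest: cells_distinct simp: Let_def card_insert_if)

lemma vertices_gasket_Suc:
  "vertices (gasket_graph (Suc n)) = vertices (gasket_graph n) \<union> (\<Union>C\<in>cells n. new_vertices C)"
proof -
  have "(\<Union>D\<in>subdivide C. cell_vertices D) = cell_vertices C \<union> new_vertices C" for C
    by (cases C) (auto simp: Let_def)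
  then show ?thesis by (simp add: gasket_graph_def UN_Un_distrib[symmetric])
qed

lemma finite_new_vertices: "finite (new_vertices C)"
  by (cases C) (simp add: Let_def)

lemma finite_vertices_gasket: "finite (vertices (gasket_graph n))"
proof -
  have "finite (cell_vertices C)" for C by (cases C) simp
  then show ?thesis by (simp add: gasket_graph_def finite_cells)
qed

text \<open>Each of the \<open>6 ^ n\<close> cells contributes four new vertices, so the count is
  \<open>3 + 4 * (6 ^ n - 1) / 5\<close>; the factor \<open>5\<close> keeps the statement within the
  naturals.\<close>

lemma card_vertices_gasket: "5 * card (vertices (gasket_graph n)) = 4 * 6 ^ n + 11"
proof (induction n)
  case 0
  show ?case by (simp add: gasket_graph_def)
next
  case (Suc n)
  have "card (\<Union>C\<in>cells n. new_vertices C) = (\<Sum>C\<in>cells n. card (new_vertices C))"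
    by (rule card_UN_disjoint) (auto simp: finite_cells finite_new_vertices dest: disjoint_new_vertices)
  also have "\<dots> = 4 * 6 ^ n" by (simp add: card_new_vertices card_cells)
  finally have "card (vertices (gasket_graph (Suc n))) = card (vertices (gasket_graph n)) + 4 * 6 ^ n"
    unfolding vertices_gasket_Suc
    by (subst card_Un_disjoint)
      (use new_vertices_disjoint_gasket finite_cells finite_new_vertices finite_vertices_gasket in auto)
  then show ?case using Suc by simp
qed

lemma tau_gasket_tree_sum:
  "real (tau (gasket_graph n)) =
     tree_sum (vertices (gasket_graph n)) (=) (concat (map (cell_edges 1) (cell_list n)))"
proof (rule tau_tree_sum)
  let ?xs = "concat (map side_list (cell_list n))"
  show "list_all2 (\<lambda>e (u, v, w). ends (gasket_graph n) e = {u, v} \<and> w = 1) ?xs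
      (concat (map (cell_edges 1) (cell_list n)))"
  proof -
    have "list_all2 (\<lambda>e (u, v, w). ends (gasket_graph n) e = {u, v} \<and> w = 1)
      (concat (map side_list cs)) (concat (map (cell_edges 1) cs))" for cs
    proof (induction cs)
      case (Cons C cs)
      have "list_all2 (\<lambda>e (u, v, w). ends (gasket_graph n) e = {u, v} \<and> w = 1)
          (side_list C) (cell_edges 1 C)"
        by (cases C) (simp add: triangle_def gasket_graph_def)
      then show ?case using Cons by (simp add: list_all2_appendI)
    qed simp
    then show ?thesis .
  qed
  have sides: "set (side_list C) = Pair C ` cell_sides C" "length (side_list C) = 3" for C
    by (cases C; auto)+
  show xs: "set ?xs = edges (gasket_graph n)"
    by (auto simp: set_cell_list sides gasket_graph_def)
  have "finite (cell_sides C)" for C by (cases C) simp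
  then have "card (edges (gasket_graph n)) = 3 * 6 ^ n"
    by (simp add: gasket_graph_def finite_cells card_cell_sides card_cells)
  \<comment> \<open>Distinctness follows by counting: the list is exactly as long as the edge set is
    large.\<close>
  moreover have "length ?xs = 3 * 6 ^ n"
    by (simp add: length_concat comp_def sides sum_list_triv length_cell_list)
  ultimately show "distinct ?xs"
    by (intro card_distinct) (simp only: xs)
  show "vertices (gasket_graph n) \<noteq> {}" using card_vertices_gasket[of n] by auto
  show "ends (gasket_graph n) f \<subseteq> vertices (gasket_graph n)" if "f \<in> edges (gasket_graph n)" for f
  proof -
    have "s \<subseteq> cell_vertices C" if "s \<in> cell_sides C" for s C
      using that by (cases C) auto
    then show ?thesis using that by (auto simp: gasket_graph_def) blast
  qed
qed

section \<open>Collapsing all cells of a level\<close>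

lemma cell_edges_vertices:
  "(u, v, w') \<in> set (cell_edges w C) \<Longrightarrow> u \<in> cell_vertices C \<and> v \<in> cell_vertices C"
  by (cases C) (auto simp: triangle_def)

text \<open>Cells can be collapsed one by one because their new vertices are disjoint.
  \<open>V\<close> and \<open>es\<close> are generalized since the cells of the tail are collapsed
  while the head is still subdivided, with its new vertices counted in \<open>V\<close> and its
  edges in \<open>es\<close>.\<close>

lemma subdivide_all_cells:
  assumes "distinct cs" "\<And>C. C \<in> set cs \<Longrightarrow> card (new_vertices C) = 4"
    and "\<And>C. C \<in> set cs \<Longrightarrow> cell_vertices C \<subseteq> V" "\<And>C. C \<in> set cs \<Longrightarrow> new_vertices C \<inter> V = {}"
    and "\<And>C u v w. C \<in> set cs \<Longrightarrow> (u, v, w) \<in> set es \<Longrightarrow> u \<notin> new_vertices C \<and> v \<notin> new_vertices C"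
  shows "tree_sum (V \<union> (\<Union>C\<in>set cs. new_vertices C)) (=)
      (concat (map (cell_edges 1) (concat (map subdivide_list cs))) @ es) =
    576 ^ length cs * tree_sum V (=) (concat (map (cell_edges (5/4)) cs) @ es)"
  using assms
proof (induction cs arbitrary: V es)
  case (Cons C cs)
  note perm = tree_sum_mset[OF identity_equivp]
  obtain a b c where C: "C = Cell a b c" by (cases C)
  let ?S = "concat (map (cell_edges 1) (subdivide_list C))"
  let ?W = "V \<union> new_vertices C"
  have nC: "new_vertices C \<inter> new_vertices D = {}" if "D \<in> set cs" for D
    using Cons.prems(1) that by (intro disjoint_new_vertices) auto
  have SV: "u \<in> ?W \<and> v \<in> ?W" if "(u, v, w) \<in> set ?S" for u v w
    using that Cons.prems(3)[of C] by (auto simp: C Let_def triangle_def)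
  have RV: "u \<in> V \<and> v \<in> V" if uvw: "(u, v, w) \<in> set (concat (map (cell_edges (5/4)) cs))" for u v w
  proof -
    obtain D where D: "D \<in> set cs" "(u, v, w) \<in> set (cell_edges (5/4) D)" using uvw by auto
    then show ?thesis using cell_edges_vertices[OF D(2)] Cons.prems(3)[of D] by auto
  qed
  have "tree_sum (V \<union> (\<Union>C\<in>set (C # cs). new_vertices C)) (=)
      (concat (map (cell_edges 1) (concat (map subdivide_list (C # cs)))) @ es) =
    tree_sum (?W \<union> (\<Union>C\<in>set cs. new_vertices C)) (=)
      (concat (map (cell_edges 1) (concat (map subdivide_list cs))) @ (?S @ es))"
    by (subst perm[of _ "concat (map (cell_edges 1) (concat (map subdivide_list cs))) @ (?S @ es)"])
      (simp_all add: Un_assoc)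
  also have "\<dots> = 576 ^ length cs * tree_sum ?W (=) (concat (map (cell_edges (5/4)) cs) @ (?S @ es))"
  proof (rule Cons.IH)
    show "distinct cs" using Cons.prems(1) by simp
    show "card (new_vertices D) = 4" if "D \<in> set cs" for D using Cons.prems(2) that by simp
    show "cell_vertices D \<subseteq> ?W" if "D \<in> set cs" for D using Cons.prems(3)[of D] that by auto
    show "new_vertices D \<inter> ?W = {}" if "D \<in> set cs" for D
      using Cons.prems(4)[of D] nC[of D] that by auto
    show "u \<notin> new_vertices D \<and> v \<notin> new_vertices D"
      if "D \<in> set cs" "(u, v, w) \<in> set (?S @ es)" for D u v w
    proof (cases "(u, v, w) \<in> set es")
      case True
      then show ?thesis using Cons.prems(5)[of D u v w] that(1) by simp
    next
      case False
      then have "u \<in> ?W \<and> v \<in> ?W" using SV[of u v w] that(2) by simp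
      then show ?thesis using Cons.prems(4)[of D] nC[of D] that(1) by auto
    qed
  qed
  also have "tree_sum ?W (=) (concat (map (cell_edges (5/4)) cs) @ (?S @ es)) =
      tree_sum ?W (=) (?S @ (concat (map (cell_edges (5/4)) cs) @ es))"
    by (rule perm) simp
  also have "\<dots> = tree_sum (V \<union> {Mid C a b, Mid C b c, Mid C c a, Bary C}) (=)
     (triangle 1 a (Mid C a b) (Bary C) @ triangle 1 (Mid C a b) b (Bary C) @
      triangle 1 b (Mid C b c) (Bary C) @ triangle 1 (Mid C b c) c (Bary C) @
      triangle 1 c (Mid C c a) (Bary C) @ triangle 1 (Mid C c a) a (Bary C) @
      concat (map (cell_edges (5/4)) cs) @ es)"
    by (simp add: C Let_def)
  \<comment> \<open>The head is collapsed last; the other cells are by then plain triangles on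
    \<open>V\<close>, which avoid its new vertices.\<close>
  also have "\<dots> = 576 * tree_sum V (=) (triangle (5/4) a b c @ concat (map (cell_edges (5/4)) cs) @ es)"
  proof (rule subdivided_triangle[OF identity_equivp])
    have new: "{Mid C a b, Mid C b c, Mid C c a, Bary C} = new_vertices C" by (simp add: C Let_def)
    then have "card {Mid C a b, Mid C b c, Mid C c a, Bary C} = 4" using Cons.prems(2)[of C] by simp
    then show "distinct [Mid C a b, Mid C b c, Mid C c a, Bary C]"
      by (intro card_distinct) simp
    show "{Mid C a b, Mid C b c, Mid C c a, Bary C} \<inter> V = {}"
      unfolding new by (rule Cons.prems(4)) simp
    show "{a, b, c} \<subseteq> V" using Cons.prems(3)[of C] by (simp add: C)
    show "fst e \<notin> {Mid C a b, Mid C b c, Mid C c a, Bary C} \<and>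
        fst (snd e) \<notin> {Mid C a b, Mid C b c, Mid C c a, Bary C}"
      if "e \<in> set (concat (map (cell_edges (5/4)) cs) @ es)" for e
    proof -
      obtain u v w where e: "e = (u, v, w)" by (cases e)
      have "u \<notin> new_vertices C \<and> v \<notin> new_vertices C"
      proof (cases "(u, v, w) \<in> set es")
        case True
        then show ?thesis using Cons.prems(5)[of C u v w] by simp
      next
        case False
        then have "u \<in> V \<and> v \<in> V" using RV[of u v w] that by (simp add: e)
        then show ?thesis using Cons.prems(4)[of C] by auto
      qed
      then show ?thesis unfolding new e by simp
    qed
  qed auto
  finally show ?case by (simp add: C mult.assoc del: tree_sum.simps)
qed simp

lemma cell_edges_scale:
  "concat (map (cell_edges k) cs) = map (\<lambda>(u, v, w). (u, v, k * w)) (concat (map (cell_edges 1) cs))"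
proof (induction cs)
  case (Cons C cs)
  then show ?case by (cases C) (simp add: triangle_def)
qed simp

text \<open>Collapsing every cell leaves the graph of level \<open>n\<close> with all weights
  \<open>5/4\<close>. Each of its spanning trees has \<open>m\<close> edges, so the common weight
  comes out as a power.\<close>

lemma tau_gasket_Suc:
  assumes "card (vertices (gasket_graph n)) = Suc m"
  shows "real (tau (gasket_graph (Suc n))) = 576 ^ 6 ^ n * (5/4) ^ m * real (tau (gasket_graph n))"
proof -
  let ?V = "vertices (gasket_graph n)" and ?cs = "cell_list n"
  have sub: "cell_vertices C \<subseteq> ?V" if "C \<in> set ?cs" for C
    using that by (auto simp: gasket_graph_def set_cell_list)
  have "real (tau (gasket_graph (Suc n))) = tree_sum (?V \<union> (\<Union>C\<in>set ?cs. new_vertices C)) (=)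
      (concat (map (cell_edges 1) (concat (map subdivide_list ?cs))) @ [])"
    by (simp add: tau_gasket_tree_sum vertices_gasket_Suc set_cell_list)
  also have "\<dots> = 576 ^ length ?cs * tree_sum ?V (=) (concat (map (cell_edges (5/4)) ?cs) @ [])"
    by (rule subdivide_all_cells[OF distinct_cell_list _ sub])
      (simp_all add: set_cell_list card_new_vertices new_vertices_disjoint_gasket)
  also have "tree_sum ?V (=) (concat (map (cell_edges (5/4)) ?cs) @ []) =
      tree_sum ?V (=) (map (\<lambda>(u, v, w). (u, v, 5/4 * w)) (concat (map (cell_edges 1) ?cs)))"
    using cell_edges_scale[of "5/4" ?cs] by simp
  also have "\<dots> = (5/4) ^ m * tree_sum ?V (=) (concat (map (cell_edges 1) ?cs))"
  \<comment> \<open>Initially every vertex is a class of its own, labelled by itself.\<close>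
  proof (rule tree_sum_scale[of _ id])
    show "u \<in> ?V \<and> v \<in> ?V" if uvw: "(u, v, w) \<in> set (concat (map (cell_edges 1) ?cs))" for u v w
    proof -
      obtain D where D: "D \<in> set ?cs" "(u, v, w) \<in> set (cell_edges 1 D)" using uvw by auto
      then show ?thesis using cell_edges_vertices[OF D(2)] sub[OF D(1)] by auto
    qed
  qed (simp_all add: assms finite_vertices_gasket)
  finally show ?thesis by (simp add: tau_gasket_tree_sum length_cell_list)
qed

theorem theorem5p3:
  fixes n :: nat
  shows "real (tau (gasket_graph n)) =
    2 powr (2 / 25 * (11 * 6 ^ n - 30 * real n - 11)) *
    3 powr (1 / 5 * (2 * 6 ^ n + 3)) *
    5 powr (1 / 25 * (4 * 6 ^ n + 30 * real n - 4))"
proof (induction n)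
  case 0
  \<comment> \<open>Level \<open>0\<close> is a triangle, whose spanning trees are the three pairs
    of its edges.\<close>
  have "real (tau (gasket_graph 0)) = 3"
    unfolding tau_gasket_tree_sum by (simp add: gasket_graph_def triangle_def join_def)
  then show ?case by simp
next
  case (Suc n)
  obtain m where m: "card (vertices (gasket_graph n)) = Suc m"
    using card_vertices_gasket[of n] by (cases "card (vertices (gasket_graph n))") auto
  have "5 * real (Suc m) = 4 * 6 ^ n + 11"
    using card_vertices_gasket[of n] unfolding m by (metis of_nat_add of_nat_mult of_nat_numeral of_nat_power)
  then have rm: "real m = 4 / 5 * 6 ^ n + 6 / 5" by simp
  define N :: real where "N = 6 ^ n"
  have N: "real (6 ^ n) = N" by (simp add: N_def)
  have "(576::real) ^ 6 ^ n = 576 powr N"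
    using powr_realpow[of 576 "6 ^ n"] by (simp add: N_def)
  also have "\<dots> = (2 powr 6 * 3 powr 2) powr N" by simp
  also have "\<dots> = 2 powr (6 * N) * 3 powr (2 * N)" by (simp only: powr_mult powr_powr)
  finally have a: "(576::real) ^ 6 ^ n = 2 powr (6 * N) * 3 powr (2 * N)" .
  \<comment> \<open>\<open>M\<close> is the real value of \<open>m\<close>, one less than the number
    of vertices at level \<open>n\<close>.\<close>
  define M where "M = 4 / 5 * N + 6 / 5"
  have "(5/4::real) ^ m = (5/4) powr M"
    using powr_realpow[of "5/4" m] by (simp add: rm M_def N_def)
  also have "\<dots> = (5 powr 1 * 2 powr (-2)) powr M" by (simp add: powr_minus)
  also have "\<dots> = 5 powr (1 * M) * 2 powr (-2 * M)" by (simp only: powr_mult powr_powr)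
  finally have b: "(5/4::real) ^ m = 5 powr M * 2 powr (-2 * M)" by simp
  \<comment> \<open>Passing from \<open>n\<close> to \<open>Suc n\<close> raises the exponents of
    \<open>2\<close>, \<open>3\<close> and \<open>5\<close> by \<open>6 N - 2 M\<close>,
    \<open>2 N\<close> and \<open>M\<close>, the contributions of the powers of \<open>576\<close>
    and \<open>5/4\<close>.\<close>
  have exps: "2 / 25 * (11 * (6 * N) - 30 * (real n + 1) - 11) = 6 * N + -2 * M + 2 / 25 * (11 * N - 30 * real n - 11)"
    "1 / 5 * (2 * (6 * N) + 3) = 2 * N + 1 / 5 * (2 * N + 3)"
    "1 / 25 * (4 * (6 * N) + 30 * (real n + 1) - 4) = M + 1 / 25 * (4 * N + 30 * real n - 4)"
    by (simp_all add: M_def field_simps)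
  have Sn: "real (Suc n) = real n + 1" by simp
  show ?case
    unfolding tau_gasket_Suc[OF m] a b Suc.IH N_def[symmetric] power_Suc Sn exps powr_add
    by (simp only: mult_ac)
qed

end
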